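(* Let $X=\mathbb{Z}^{\mathbb{N}}$ and let $G=\mathrm{Hom}(X,\mathbb{Z})$ be the group of all group homomorphisms from $X$ to $\mathbb{Z}$, endowed with the topology of pointwise convergence on $X$. Then the second Pontryagin dual $\widehat{\widehat{G}}$ of $G$ is discrete and algebraically isomorphic to $G$ (i.e. isomorphic to $G$ as an abstract group).
   Context: $\mathbb{Z}$ is the group of integers with the discrete topology. $X=\mathbb{Z}^{\mathbb{N}}$ is the Baer-Specker group, i.e. the group of all functions $\mathbb{N}\to\mathbb{Z}$ under pointwise addition. $\mathrm{Hom}(X,\mathbb{Z})$ consists of all (abstract, not assumed continuous) group homomorphisms $X\to\mathbb{Z}$, with pointwise addition. The topology of pointwise convergence on $G$ is the subspace topology inherited from the Tychonoff product $\mathbb{Z}^{X}$. $\mathbb{T}=\mathbb{R}/\mathbb{Z}$ is the circle group. For an abelian topological group $H$, the (Pontryagin) dual group $\widehat{H}$ is the group of all continuous homomorphisms $H\to\mathbb{T}$ (characters) with pointwise addition, equipped with the compact-open topology. The second dual is $\widehat{\widehat{H}}$, the dual of $\widehat{H}$. *)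

theory Defs
  imports "HOL-Analysis.Function_Topology" "HOL-Algebra.Product_Groups"
begin

text \<open>
  A topological group is a group record extended by a topology on its carrier. As usual in
  HOL-Algebra, groups are written multiplicatively, also those that are additive on paper.
\<close>

record 'a top_group = "'a monoid" +
  group_topology :: "'a topology"

text \<open>
  The group of homomorphisms from \<open>X\<close> to \<open>A\<close> under the pointwise operation, as a subgroup of the
  power of \<open>A\<close> indexed by the elements of \<open>X\<close>. Elements of that power are functions restricted
  to \<open>carrier X\<close>, so that equal homomorphisms are equal as HOL functions.
\<close>

definition hom_group :: "('a, 'm) monoid_scheme \<Rightarrow> ('b, 'n) monoid_scheme \<Rightarrow> ('a \<Rightarrow> 'b) monoid" where
  "hom_group X A =
     (product_group (carrier X) (\<lambda>_. A)) \<lparr>carrier := hom X A \<inter> extensional (carrier X)\<rparr>"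

definition pointwise_hom_group ::
    "('a, 'm) monoid_scheme \<Rightarrow> 'b top_group \<Rightarrow> ('a \<Rightarrow> 'b) top_group" where
  "pointwise_hom_group X A =
     monoid.extend (hom_group X A)
       (top_group.fields
         (subtopology (product_topology (\<lambda>_. group_topology A) (carrier X))
           (carrier (hom_group X A))))"

definition discrete_int_group :: "int top_group" where
  "discrete_int_group =
     monoid.extend integer_group (top_group.fields (discrete_topology UNIV))"

definition real_additive_group :: "real monoid" where
  "real_additive_group = \<lparr>carrier = UNIV, monoid.mult = (+), one = 0\<rparr>"

text \<open>The quotient topology on \<open>\<real>/\<int>\<close>; \<open>\<int> #> x\<close> is the coset of \<open>x\<close>.\<close>

definition circle_topology :: "real set topology" where
  "circle_topology =
     topology (\<lambda>U. U \<subseteq> carrier (real_additive_group Mod \<int>) \<and>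
                   open {x. \<int> #>\<^bsub>real_additive_group\<^esub> x \<in> U})"

definition circle_group :: "real set top_group" where
  "circle_group =
     monoid.extend (real_additive_group Mod \<int>) (top_group.fields circle_topology)"

text \<open>
  Justifies the use of \<^const>\<open>topology\<close> above, which is unspecified on predicates that are not
  topologies.
\<close>

lemma openin_circle_topology:
  "openin circle_topology U \<longleftrightarrow>
     U \<subseteq> carrier (real_additive_group Mod \<int>) \<and>
     open {x. \<int> #>\<^bsub>real_additive_group\<^esub> x \<in> U}"
proof -
  let ?q = "\<lambda>x. \<int> #>\<^bsub>real_additive_group\<^esub> x"
  have eqs: "{x. ?q x \<in> S \<inter> T} = {x. ?q x \<in> S} \<inter> {x. ?q x \<in> T}"
            "{x. ?q x \<in> \<Union>K} = (\<Union>S\<in>K. {x. ?q x \<in> S})" for S T K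
    by auto
  have "istopology (\<lambda>U. U \<subseteq> carrier (real_additive_group Mod \<int>) \<and> open {x. ?q x \<in> U})"
    unfolding istopology_def eqs by (blast intro: open_Int open_UN)
  then show ?thesis
    by (simp add: circle_topology_def topology_inverse')
qed

definition characters :: "'a top_group \<Rightarrow> ('a \<Rightarrow> real set) set" where
  "characters H =
     {\<chi> \<in> carrier (hom_group H circle_group).
        continuous_map (group_topology H) (group_topology circle_group) \<chi>}"

definition compact_open_topology :: "'a topology \<Rightarrow> 'b topology \<Rightarrow> ('a \<Rightarrow> 'b) set \<Rightarrow> ('a \<Rightarrow> 'b) topology" where
  "compact_open_topology S T F =
     topology_generated_by {{f \<in> F. f ` K \<subseteq> U} | K U. compactin S K \<and> openin T U}"

lemma topspace_compact_open_topology: "topspace (compact_open_topology S T F) = F"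
proof -
  have "F \<in> {{f \<in> F. f ` K \<subseteq> U} | K U. compactin S K \<and> openin T U}"
    by (rule CollectI, rule exI[of _ "{}"], rule exI[of _ "{}"]) auto
  then show ?thesis
    unfolding compact_open_topology_def topology_generated_by_topspace by blast
qed

definition pontryagin_dual :: "'a top_group \<Rightarrow> ('a \<Rightarrow> real set) top_group" where
  "pontryagin_dual H =
     monoid.extend ((hom_group H circle_group) \<lparr>carrier := characters H\<rparr>)
       (top_group.fields
         (compact_open_topology (group_topology H) (group_topology circle_group)
           (characters H)))"

definition baer_specker_group :: "(nat \<Rightarrow> int) monoid" where
  "baer_specker_group = product_group UNIV (\<lambda>_. integer_group)"

end

theory Submission
  imports Defs "HOL-Analysis.Elementary_Normed_Spaces" "HOL-Analysis.T1_Spaces"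
begin

text \<open>
  By Specker, a homomorphism \<open>f : \<int>\<^sup>\<nat> \<rightarrow> \<int>\<close> is determined by its coordinates \<open>f\<^sub>n = f (unit_seq n)\<close>, almost
  all of which vanish, and a compact set in the pointwise topology has a common bound on its
  supports. Hence every neighbourhood of \<open>0\<close> in the dual contains all characters that vanish on the
  functionals supported below some \<open>m\<close>. The circle has no small subgroups, so a character \<open>\<psi>\<close> of the
  dual depends on finitely many coordinates only. On the circle of characters \<open>f \<mapsto> t f\<^sub>n\<close> it is
  multiplication by an integer \<open>k\<^sub>n\<close>, and \<open>\<psi>\<close> is the evaluation at the functional with coordinates \<open>k\<^sub>n\<close>.
  For discreteness, arcs of these circles for all \<open>n\<close> together form a compact set, because the
  circles converge to \<open>0\<close>; a suitable choice of arcs isolates a given evaluation up to finitely many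
  others.
\<close>

section \<open>Homomorphisms on the Baer-Specker group\<close>

definition unit_seq :: "nat \<Rightarrow> nat \<Rightarrow> int" where
  "unit_seq n = (\<lambda>i. if i = n then 1 else 0)"

text \<open>The carrier of the Baer-Specker group is a whole type, so extensionality is vacuous and
  additivity alone singles out the elements of Hom(X, Z).\<close>

definition additive_functional :: "((nat \<Rightarrow> int) \<Rightarrow> int) \<Rightarrow> bool" where
  "additive_functional f \<longleftrightarrow> (\<forall>x y. f (\<lambda>i. x i + y i) = f x + f y)"

lemma additive_functionalD:
  "additive_functional f \<Longrightarrow> f (\<lambda>i. x i + y i) = f x + f y"
  by (simp add: additive_functional_def)

lemma additive_functional_zero: "additive_functional f \<Longrightarrow> f (\<lambda>i. 0) = 0"
  using additive_functionalD[of f "\<lambda>i. 0" "\<lambda>i. 0"] by simp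

lemma additive_functional_uminus: "additive_functional f \<Longrightarrow> f (\<lambda>i. - x i) = - f x"
  using additive_functionalD[of f x "\<lambda>i. - x i"] additive_functional_zero[of f] by simp

lemma additive_functional_nat_scale:
  assumes "additive_functional f"
  shows "f (\<lambda>i. int c * x i) = int c * f x"
proof (induction c)
  case (Suc c)
  have "f (\<lambda>i. x i + int c * x i) = f x + f (\<lambda>i. int c * x i)"
    using assms by (rule additive_functionalD)
  with Suc show ?case by (simp add: algebra_simps)
qed (simp add: additive_functional_zero[OF assms])

lemma additive_functional_scale:
  assumes "additive_functional f"
  shows "f (\<lambda>i. c * x i) = c * f x"
proof (cases c rule: int_cases2)
  case (nonneg n)
  then show ?thesis using additive_functional_nat_scale[OF assms] by simp
next
  case (nonpos n)
  then show ?thesis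
    using additive_functional_nat_scale[OF assms, of n x]
      additive_functional_uminus[OF assms, of "\<lambda>i. int n * x i"] by simp
qed

text \<open>Coordinates are peeled off one at a time. The tail stays as a separate term because an
  abstract homomorphism is not assumed to respect infinite sums.\<close>

lemma additive_functional_split:
  assumes "additive_functional f"
  shows "f x = (\<Sum>n<m. f (unit_seq n) * x n) + f (\<lambda>i. if i < m then 0 else x i)"
proof (induction m)
  case (Suc m)
  have "(\<lambda>i. if i < m then 0 else x i)
      = (\<lambda>i. x m * unit_seq m i + (if i < Suc m then 0 else x i))"
    by (auto simp: unit_seq_def fun_eq_iff less_Suc_eq)
  then have "f (\<lambda>i. if i < m then 0 else x i)
      = x m * f (unit_seq m) + f (\<lambda>i. if i < Suc m then 0 else x i)"
    using additive_functionalD[OF assms, of "\<lambda>i. x m * unit_seq m i"]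
      additive_functional_scale[OF assms, of "x m" "unit_seq m"] by simp
  with Suc show ?case by (simp add: mult.commute)
qed simp

text \<open>The tail is \<open>d\<close> times another sequence, so its value is \<open>d\<close>
  times an integer. Such congruences are what controls the tail below.\<close>

lemma additive_functional_dvd_tail:
  assumes f: "additive_functional f" and d: "\<And>i. i \<ge> m \<Longrightarrow> d dvd x i"
  shows "d dvd f x - (\<Sum>n<m. f (unit_seq n) * x n)"
proof -
  define y where "y i = (if i < m then 0 else x i div d)" for i
  have "(\<lambda>i. if i < m then 0 else x i) = (\<lambda>i. d * y i)"
    using d by (auto simp: y_def fun_eq_iff)
  then have "f (\<lambda>i. if i < m then 0 else x i) = d * f y"
    using additive_functional_scale[OF f] by simp
  then show ?thesis
    using additive_functional_split[OF f, of x m] by simp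
qed

lemma int_eq_0_if_dvd_powers:
  fixes z :: int
  assumes "b > 1" "\<And>m::nat. b ^ m dvd z"
  shows "z = 0"
proof (rule ccontr)
  assume "z \<noteq> 0"
  obtain m where m: "\<bar>z\<bar> < b ^ m"
    using assms(1) by (metis real_arch_pow of_int_less_iff of_int_power of_int_1)
  from zdvd_imp_le[of "b ^ m" "\<bar>z\<bar>"] assms(2)[of m] \<open>z \<noteq> 0\<close> m show False by simp
qed

text \<open>Every sequence splits as \<open>2\<^sup>n a\<^sub>n + 3\<^sup>n b\<^sub>n\<close>; the value on either
  part is divisible by all powers of \<open>2\<close>, respectively \<open>3\<close>.\<close>

lemma additive_functional_eq_0:
  assumes f: "additive_functional f" and 0: "\<And>n. f (unit_seq n) = 0"
  shows "f x = 0"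
proof -
  have powers: "f (\<lambda>i. b ^ i * y i) = 0" if "b > 1" for b :: int and y
  proof (rule int_eq_0_if_dvd_powers[OF that])
    fix m
    show "b ^ m dvd f (\<lambda>i. b ^ i * y i)"
      using additive_functional_dvd_tail[OF f, of m "b ^ m" "\<lambda>i. b ^ i * y i"] 0
      by (simp add: le_imp_power_dvd)
  qed
  have "\<exists>a b. x i = 2 ^ i * a + 3 ^ i * b" for i
  proof -
    have "coprime (2 ^ i) (3 ^ i :: int)" by simp
    then obtain u v where "u * 2 ^ i + v * 3 ^ i = (1::int)"
      using bezout_int[of "2^i" "3^i"] by (auto simp: coprime_iff_gcd_eq_1)
    then have "(u * 2 ^ i + v * 3 ^ i) * x i = x i" by simp
    then have "x i = 2 ^ i * (u * x i) + 3 ^ i * (v * x i)"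
      by (simp add: algebra_simps)
    then show ?thesis by blast
  qed
  then obtain a b where "x = (\<lambda>i. 2 ^ i * a i + 3 ^ i * b i)" by metis
  then show ?thesis
    using additive_functionalD[OF f] powers[of 2] powers[of 3] by simp
qed

section \<open>Specker's theorem: finite support and the finite sum formula\<close>

fun growing_seq :: "(nat \<Rightarrow> int) \<Rightarrow> nat \<Rightarrow> int" where
  "growing_seq a 0 = 1"
| "growing_seq a (Suc m) =
     growing_seq a m * (\<bar>\<Sum>j<Suc m. a j * growing_seq a j\<bar> + int m + 2)"

lemma growing_seq_pos: "growing_seq a m > 0"
  by (induction m) (auto intro!: mult_pos_pos add_nonneg_pos)

lemma growing_seq_dvd: "m \<le> n \<Longrightarrow> growing_seq a m dvd growing_seq a n"
  by (induction n rule: nat_induct_at_least) (auto simp: dvd_mult2)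

text \<open>The last factor alone exceeds the bound, and the preceding term is at least 1. The
  summand \<open>int m\<close> lets the bound eventually beat any fixed value
  \<open>f d\<close>.\<close>

lemma growing_seq_ge:
  "growing_seq a m \<ge> \<bar>\<Sum>j<m. a j * growing_seq a j\<bar> + int m"
proof (cases m)
  case (Suc k)
  have "\<bar>\<Sum>j<m. a j * growing_seq a j\<bar> + int m \<le> 1 * (\<bar>\<Sum>j<m. a j * growing_seq a j\<bar> + int k + 2)"
    using Suc by simp
  also have "\<dots> \<le> growing_seq a k * (\<bar>\<Sum>j<m. a j * growing_seq a j\<bar> + int k + 2)"
    using growing_seq_pos[of a k] by (intro mult_right_mono) auto
  finally show ?thesis using Suc by simp
qed simp

text \<open>At the sequence \<open>d\<close> grown from \<open>a\<^sub>n = f (unit_seq n)\<close>, the value \<open>f d\<close> is congruent to the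
  \<open>m\<close>-th partial sum of \<open>\<Sum> a\<^sub>n d\<^sub>n\<close> modulo \<open>d\<^sub>m\<close>, which exceeds both in absolute value for large
  \<open>m\<close>. So the partial sums are eventually constant.\<close>

lemma additive_functional_finite_support:
  assumes f: "additive_functional f"
  shows "\<exists>m. \<forall>n\<ge>m. f (unit_seq n) = 0"
proof -
  define a where "a n = f (unit_seq n)" for n
  define d where "d = growing_seq a"
  define S where "S m = (\<Sum>j<m. a j * d j)" for m
  have eq: "f d = S m" if "int m > \<bar>f d\<bar>" for m
  proof (rule ccontr)
    assume "f d \<noteq> S m"
    moreover have "d m dvd f d - S m"
      unfolding S_def a_def
      by (rule additive_functional_dvd_tail[OF f]) (simp add: d_def growing_seq_dvd)
    ultimately have "d m \<le> \<bar>f d - S m\<bar>"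
      by (intro zdvd_imp_le) auto
    moreover have "d m \<ge> \<bar>S m\<bar> + int m"
      unfolding d_def S_def by (rule growing_seq_ge)
    ultimately show False using that by linarith
  qed
  have "a n = 0" if "n \<ge> nat (\<bar>f d\<bar> + 1)" for n
  proof -
    have "S n = f d" "S (Suc n) = f d" using that by (intro eq[symmetric]; linarith)+
    then have "a n * d n = 0" by (simp add: S_def)
    then show ?thesis using growing_seq_pos[of a n] by (simp add: d_def)
  qed
  then show ?thesis by (auto simp: a_def)
qed

text \<open>The difference of both sides is additive in \<open>x\<close> and vanishes on all unit
  sequences, so \<open>additive_functional_eq_0\<close> applies to it.\<close>

lemma specker_sum:
  assumes f: "additive_functional f" and m: "\<And>n. n \<ge> m \<Longrightarrow> f (unit_seq n) = 0"
  shows "f x = (\<Sum>n<m. f (unit_seq n) * x n)"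
proof -
  define g where "g x = f x - (\<Sum>n<m. f (unit_seq n) * x n)" for x
  have "additive_functional g"
    using f by (simp add: g_def additive_functional_def algebra_simps sum.distrib)
  moreover have "g (unit_seq k) = 0" for k
  proof -
    have "(\<Sum>n<m. f (unit_seq n) * unit_seq k n) = (\<Sum>n<m. if n = k then f (unit_seq k) else 0)"
      by (intro sum.cong) (auto simp: unit_seq_def)
    also have "\<dots> = f (unit_seq k)"
      using m[of k] by auto
    finally show ?thesis by (simp add: g_def)
  qed
  ultimately have "g x = 0" by (rule additive_functional_eq_0)
  then show ?thesis by (simp add: g_def)
qed

lemma additive_functional_eqI:
  assumes f: "additive_functional f" and g: "additive_functional g"
    and eq: "\<And>n. f (unit_seq n) = g (unit_seq n)"
  shows "f = g"
proof
  fix x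
  have "additive_functional (\<lambda>x. f x - g x)"
    using f g by (simp add: additive_functional_def)
  from additive_functional_eq_0[OF this, of x] eq show "f x = g x" by simp
qed

section \<open>Uniform bounds on supports by a diagonal argument\<close>

fun escaping_seq :: "(nat \<Rightarrow> nat \<Rightarrow> int) \<Rightarrow> nat \<Rightarrow> int" where
  "escaping_seq a n = int n + \<bar>\<Sum>j<n. a n j * escaping_seq a j\<bar>"

declare escaping_seq.simps [simp del]

text \<open>Otherwise \<open>C\<close> contains functionals whose last nonzero coordinate is arbitrarily late, and
  a sequence growing fast enough takes arbitrarily large values on them.\<close>

lemma pointwise_finite_imp_common_support:
  assumes C: "\<And>f. f \<in> C \<Longrightarrow> additive_functional f"
    and fin: "\<And>x. finite ((\<lambda>f. f x) ` C)"
  shows "\<exists>m. \<forall>f\<in>C. \<forall>n\<ge>m. f (unit_seq n) = 0"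
proof -
  define last where
    "last f n \<longleftrightarrow> f (unit_seq n) \<noteq> 0 \<and> (\<forall>k>n. f (unit_seq k) = 0)"
    for f :: "(nat \<Rightarrow> int) \<Rightarrow> int" and n
  \<comment> \<open>One representative for each index at which some member of \<open>C\<close> ends.
    At other indices the choice is unspecified; its property is used only where a representative
    exists.\<close>
  define F where "F n = (SOME f. f \<in> C \<and> last f n)" for n
  have F: "F n \<in> C" "last (F n) n" if "f \<in> C" "last f n" for f n
    using someI[of "\<lambda>f. f \<in> C \<and> last f n" f] that by (auto simp: F_def)
  define x where "x = escaping_seq (\<lambda>n j. F n (unit_seq j))"
  obtain B where B: "\<And>f. f \<in> C \<Longrightarrow> \<bar>f x\<bar> \<le> B"
  proof -
    have "finite ((\<lambda>f. \<bar>f x\<bar>) ` C)"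
      using finite_imageI[OF fin[of x], of abs] by (simp add: image_image)
    then show ?thesis using that[of "Max ((\<lambda>f. \<bar>f x\<bar>) ` C)"] by simp
  qed
  have bound: "int n \<le> B" if "f \<in> C" "last f n" for f n
  proof -
    let ?g = "F n" and ?s = "\<Sum>j<n. F n (unit_seq j) * x j"
    have g: "?g \<in> C" "?g (unit_seq n) \<noteq> 0" "\<And>k. k \<ge> Suc n \<Longrightarrow> ?g (unit_seq k) = 0"
      using F[OF that] by (auto simp: last_def)
    have xn: "x n = int n + \<bar>?s\<bar>"
      unfolding x_def by (subst escaping_seq.simps) simp
    have "?g x = ?s + ?g (unit_seq n) * x n"
      using specker_sum[OF C[OF g(1)] g(3), where x = x] by simp
    \<comment> \<open>The leading coordinate is a nonzero integer, so this term has size at least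
      \<open>x n\<close>, which exceeds the size of the earlier contribution \<open>?s\<close> by
      \<open>n\<close>.\<close>
    moreover have "\<bar>?g (unit_seq n) * x n\<bar> \<ge> 1 * x n"
      unfolding abs_mult using g(2) xn by (intro mult_mono) auto
    ultimately have "\<bar>?g x\<bar> \<ge> int n" using xn by linarith
    with B[OF g(1)] show ?thesis by linarith
  qed
  have "f (unit_seq n) = 0" if f: "f \<in> C" and n: "n \<ge> nat B + 1" for f n
  proof (rule ccontr)
    assume nz: "f (unit_seq n) \<noteq> 0"
    obtain m where m: "\<forall>k\<ge>m. f (unit_seq k) = 0"
      using additive_functional_finite_support[OF C[OF f]] by blast
    let ?S = "{k. f (unit_seq k) \<noteq> 0}"
    have fS: "finite ?S" using m by (metis (mono_tags, lifting) finite_nat_set_iff_bounded mem_Collect_eq not_less)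
    have "last f (Max ?S)"
      unfolding last_def
    proof (intro conjI allI impI)
      show "f (unit_seq (Max ?S)) \<noteq> 0" using Max_in[OF fS] nz by blast
      show "f (unit_seq k) = 0" if "k > Max ?S" for k
        using Max_ge[OF fS, of k] that by (auto simp: not_less[symmetric])
    qed
    from bound[OF f this] have "int (Max ?S) \<le> B" .
    moreover have "n \<le> Max ?S" using Max_ge[OF fS, of n] nz by simp
    ultimately show False using n by linarith
  qed
  then show ?thesis by blast
qed

section \<open>The circle group\<close>

text \<open>Let \<open>r\<close> be the offset of \<open>s\<close> from a nearby integer. If
  \<open>2 ^ i * r\<close> is within 1/3 of 0, its double is within 2/3 of 0 and within 1/3 of an
  integer, which must then be 0. So all doublings of \<open>r\<close> stay bounded, and
  \<open>r = 0\<close>.\<close>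

lemma Ints_if_doublings_near_Ints:
  fixes s :: real
  assumes "\<And>i::nat. \<exists>n\<in>\<int>. \<bar>2 ^ i * s - n\<bar> < 1/3"
  shows "s \<in> \<int>"
proof -
  from assms[of 0] obtain n where n: "n \<in> \<int>" "\<bar>s - n\<bar> < 1/3" by auto
  define r where "r = s - n"
  have small: "\<bar>2 ^ i * r\<bar> < 1/3" for i :: nat
  proof (induction i)
    case 0
    then show ?case using n by (simp add: r_def)
  next
    case (Suc i)
    obtain k where k: "k \<in> \<int>" "\<bar>2 ^ Suc i * s - k\<bar> < 1/3" using assms by blast
    define l where "l = k - 2 ^ Suc i * n"
    have "l \<in> \<int>" unfolding l_def using k n by simp
    have "\<bar>2 ^ Suc i * r - l\<bar> < 1/3" using k by (simp add: l_def r_def algebra_simps)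
    moreover have "\<bar>2 ^ Suc i * r\<bar> < 2/3" using Suc by (simp add: abs_mult mult.commute)
    ultimately have "\<bar>l\<bar> < 1" by linarith
    with \<open>l \<in> \<int>\<close> have "l = 0" by (auto elim!: Ints_cases)
    with \<open>\<bar>2 ^ Suc i * r - l\<bar> < 1/3\<close> show ?case by simp
  qed
  have "r = 0"
  proof (rule ccontr)
    assume "r \<noteq> 0"
    obtain i :: nat where "1 / (3 * \<bar>r\<bar>) < 2 ^ i" using real_arch_pow[of 2] by auto
    with small[of i] \<open>r \<noteq> 0\<close> show False by (simp add: abs_mult field_simps)
  qed
  with n show ?thesis by (simp add: r_def)
qed

text \<open>Subtract the linear map \<open>k t\<close> that agrees with \<open>H\<close> at \<open>1 / N\<close> modulo \<open>\<int>\<close>. The difference has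
  period \<open>1 / N\<close> modulo \<open>\<int>\<close>, so its image is a subgroup of the circle close to \<open>0\<close>.\<close>

lemma circle_character_lift:
  fixes H :: "real \<Rightarrow> real"
  assumes add: "\<And>s t. H (s + t) - (H s + H t) \<in> \<int>" and one: "H 1 \<in> \<int>"
    and \<delta>: "\<delta> > 0" and near: "\<And>t. \<bar>t\<bar> < \<delta> \<Longrightarrow> \<exists>n\<in>\<int>. \<bar>H t - n\<bar> < 1/6"
  shows "\<exists>k::int. \<forall>t. H t - of_int k * t \<in> \<int>"
proof -
  obtain N :: nat where N: "N > 0" "1 / real N < \<delta>"
    using \<delta> by (metis nat_approx_posE zero_less_Suc)
  have mult: "H (real n * s) - real n * H s \<in> \<int>" if "n > 0" for n s
    using that
  proof (induction n rule: nat_induct_non_zero)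
    case (Suc n)
    have "H (real (Suc n) * s) - real (Suc n) * H s
        = (H (s + real n * s) - (H s + H (real n * s))) + (H (real n * s) - real n * H s)"
      by (simp add: algebra_simps)
    then show ?case using add Suc by (metis Ints_add)
  qed simp
  obtain m where m: "m \<in> \<int>" "\<bar>H (1 / real N) - m\<bar> < 1/6"
    using near[of "1 / real N"] N by auto
  \<comment> \<open>The small representative of \<open>H (1 / real N)\<close> modulo integers. Since
    \<open>H 1\<close> is an integer, so is \<open>real N * c\<close>, and this integer is the slope
    \<open>k\<close>.\<close>
  define c where "c = H (1 / real N) - m"
  have "real N * c = - (H 1 - real N * H (1 / real N)) + (H 1 - real N * m)"
    by (simp add: c_def algebra_simps)
  moreover have "H 1 - real N * H (1 / real N) \<in> \<int>"
    using mult[OF N(1), of "1 / real N"] N by simp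
  ultimately have "real N * c \<in> \<int>" using one m(1) by simp
  then obtain k :: int where k: "real N * c = of_int k" by (elim Ints_cases)
  define g where "g t = H t - of_int k * t" for t
  have gadd: "g (s + t) - (g s + g t) \<in> \<int>" for s t
    using add[of s t] by (simp add: g_def algebra_simps)
  have gN: "g (1 / real N) \<in> \<int>"
  proof -
    have "c = of_int k / real N" using k N by (simp add: field_simps)
    then have "g (1 / real N) = m" by (simp add: g_def c_def)
    with m show ?thesis by simp
  qed
  have gmult: "g (real n * s) - real n * g s \<in> \<int>" if "n > 0" for n s
    using mult[OF that, of s] by (simp add: g_def algebra_simps)
  have g0: "g 0 \<in> \<int>" using gadd[of 0 0] by (simp add: minus_in_Ints_iff)
  have gperiod_nat: "g (real n / real N) \<in> \<int>" for n
  proof (cases "n = 0")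
    case True
    then show ?thesis using g0 by simp
  next
    case False
    then have "g (real n / real N) - real n * g (1 / real N) \<in> \<int>"
      using gmult[of n "1 / real N"] by simp
    then have "(g (real n / real N) - real n * g (1 / real N)) + real n * g (1 / real N) \<in> \<int>"
      using gN by (intro Ints_add Ints_mult) auto
    then show ?thesis by simp
  qed
  have gperiod: "g (of_int n / real N) \<in> \<int>" for n :: int
  proof (cases n rule: int_cases2)
    case (nonneg j)
    then show ?thesis using gperiod_nat[of j] by simp
  next
    case (nonpos j)
    have "g (of_int n / real N) = g 0 - g (real j / real N)
        - (g (of_int n / real N + real j / real N) - (g (of_int n / real N) + g (real j / real N)))"
      using nonpos by simp
    also have "\<dots> \<in> \<int>"
      by (intro Ints_diff g0 gperiod_nat gadd)
    finally show ?thesis .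
  qed
  have gsmall: "\<exists>n\<in>\<int>. \<bar>g t - n\<bar> < 1/3" for t
  proof -
    \<comment> \<open>Reduce \<open>t\<close> modulo \<open>1 / real N\<close> to \<open>r\<close>.
      There \<open>H\<close> is within 1/6 of an integer, since
      \<open>1 / real N < \<delta>\<close>, and \<open>k * r\<close> has size at most
      \<open>\<bar>c\<bar> < 1/6\<close>. The two errors add up to less than 1/3.\<close>
    define p where "p = \<lfloor>t * real N\<rfloor>"
    define r where "r = t - of_int p / real N"
    have r: "0 \<le> r" "r \<le> 1 / real N"
    proof -
      have "of_int p \<le> t * real N" "t * real N \<le> of_int p + 1" unfolding p_def by linarith+
      moreover have "r * real N = t * real N - of_int p" using N(1) by (simp add: r_def field_simps)
      ultimately have "0 \<le> r * real N" "r * real N \<le> 1" by linarith+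
      then show "0 \<le> r" "r \<le> 1 / real N" using N(1) by (simp_all add: zero_le_mult_iff pos_le_divide_eq)
    qed
    obtain n where n: "n \<in> \<int>" "\<bar>H r - n\<bar> < 1/6" using near[of r] r N by auto
    have "\<bar>of_int k * r\<bar> = \<bar>c\<bar> * (real N * r)" using k r by (simp add: abs_mult flip: k)
    also have "\<dots> \<le> \<bar>c\<bar> * 1"
      using r N(1) by (intro mult_left_mono) (auto simp: field_simps)
    also have "\<dots> < 1/6" using m by (simp add: c_def)
    finally have "\<bar>g r - n\<bar> < 1/3" using n unfolding g_def by linarith
    moreover have "g t - g r \<in> \<int>"
    proof -
      have "g t - g r = (g (r + of_int p / real N) - (g r + g (of_int p / real N))) + g (of_int p / real N)"
        by (simp add: r_def)
      then show ?thesis using gadd gperiod by (metis Ints_add)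
    qed
    ultimately show ?thesis using n(1)
      by (intro bexI[of _ "(g t - g r) + n"]) auto
  qed
  have "g t \<in> \<int>" for t
  proof (rule Ints_if_doublings_near_Ints)
    fix i :: nat
    obtain n where n: "n \<in> \<int>" "\<bar>g (2 ^ i * t) - n\<bar> < 1/3" using gsmall by blast
    have "g (2 ^ i * t) - 2 ^ i * g t \<in> \<int>" using gmult[of "2 ^ i" t] by simp
    then show "\<exists>n\<in>\<int>. \<bar>2 ^ i * g t - n\<bar> < 1/3"
      using n by (intro bexI[of _ "n - (g (2 ^ i * t) - 2 ^ i * g t)"]) auto
  qed
  then show ?thesis unfolding g_def by blast
qed

section \<open>The quotient map from the reals onto the circle\<close>

definition circle_of :: "real \<Rightarrow> real set" where
  "circle_of x = \<int> #>\<^bsub>real_additive_group\<^esub> x"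

lemma circle_of_eq: "circle_of x = {n + x | n. n \<in> \<int>}"
  by (auto simp: circle_of_def r_coset_def real_additive_group_def)

lemma circle_of_eq_iff: "circle_of x = circle_of y \<longleftrightarrow> x - y \<in> \<int>"
proof
  assume eq: "circle_of x = circle_of y"
  have "x \<in> circle_of x" by (auto simp: circle_of_eq intro!: exI[of _ 0])
  with eq obtain n where "n \<in> \<int>" "x = n + y" by (auto simp: circle_of_eq)
  then show "x - y \<in> \<int>" by simp
next
  assume d: "x - y \<in> \<int>"
  have "n + x = (n + (x - y)) + y" "n + y = (n - (x - y)) + x" for n by simp_all
  with d have "circle_of x \<subseteq> circle_of y" "circle_of y \<subseteq> circle_of x"
    unfolding circle_of_eq using Ints_add Ints_diff by blast+
  then show "circle_of x = circle_of y" by (rule antisym)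
qed

lemma carrier_circle_group: "carrier circle_group = range circle_of"
  by (auto simp: circle_group_def monoid.defs carrier_FactGroup real_additive_group_def
      circle_of_def image_def)

lemma circle_of_in_carrier [simp]: "circle_of x \<in> carrier circle_group"
  by (simp add: carrier_circle_group)

lemma circle_group_ex: "z \<in> carrier circle_group \<Longrightarrow> \<exists>x. z = circle_of x"
  by (auto simp: carrier_circle_group)

lemma circle_of_mult [simp]: "circle_of x \<otimes>\<^bsub>circle_group\<^esub> circle_of y = circle_of (x + y)"
proof -
  have "circle_of x \<otimes>\<^bsub>circle_group\<^esub> circle_of y = circle_of x <#>\<^bsub>real_additive_group\<^esub> circle_of y"
    by (simp add: circle_group_def monoid.defs)
  also have "\<dots> = circle_of (x + y)"
  proof (intro Set.set_eqI iffI)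
    fix z assume "z \<in> circle_of x <#>\<^bsub>real_additive_group\<^esub> circle_of y"
    then obtain m n where "m \<in> \<int>" "n \<in> \<int>" "z = (m + x) + (n + y)"
      by (auto simp: set_mult_def circle_of_eq real_additive_group_def)
    then show "z \<in> circle_of (x + y)"
      by (auto simp: circle_of_eq intro!: exI[of _ "m + n"])
  next
    fix z assume "z \<in> circle_of (x + y)"
    then obtain n where "n \<in> \<int>" "z = (n + x) + (0 + y)"
      by (auto simp: circle_of_eq)
    then show "z \<in> circle_of x <#>\<^bsub>real_additive_group\<^esub> circle_of y"
      unfolding set_mult_def circle_of_eq real_additive_group_def by force
  qed
  finally show ?thesis .
qed

lemma topspace_circle: "topspace (group_topology circle_group) = carrier circle_group"
proof -
  have "openin circle_topology (carrier (real_additive_group Mod \<int>))"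
    unfolding openin_circle_topology
    by (simp add: carrier_FactGroup real_additive_group_def)
  then have "topspace circle_topology = carrier (real_additive_group Mod \<int>)"
    by (intro antisym openin_subset) (use openin_topspace openin_circle_topology in blast)
  then show ?thesis by (simp add: circle_group_def monoid.defs top_group.defs)
qed

lemma openin_circle_iff:
  "openin (group_topology circle_group) U \<longleftrightarrow>
     U \<subseteq> carrier circle_group \<and> open {x. circle_of x \<in> U}"
  by (simp add: circle_group_def monoid.defs top_group.defs openin_circle_topology circle_of_def)

text \<open>The preimage of the image is the union of all integer translates of \<open>A\<close>, so
  the quotient map is open.\<close>

lemma openin_circle_image:
  assumes "open A"
  shows "openin (group_topology circle_group) (circle_of ` A)"
proof -
  have "{x. circle_of x \<in> circle_of ` A} = (\<Union>n\<in>\<int>. (\<lambda>a. n + a) ` A)"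
  proof (intro Set.set_eqI iffI)
    fix x assume "x \<in> {x. circle_of x \<in> circle_of ` A}"
    then obtain a where "a \<in> A" "x - a \<in> \<int>" by (auto simp: circle_of_eq_iff)
    then show "x \<in> (\<Union>n\<in>\<int>. (\<lambda>a. n + a) ` A)" by (force intro!: bexI[of _ "x - a"])
  next
    fix x assume "x \<in> (\<Union>n\<in>\<int>. (\<lambda>a. n + a) ` A)"
    then obtain n a where "n \<in> \<int>" "a \<in> A" "x = n + a" by blast
    then have "circle_of x = circle_of a" by (simp add: circle_of_eq_iff)
    with \<open>a \<in> A\<close> show "x \<in> {x. circle_of x \<in> circle_of ` A}" by blast
  qed
  moreover have "open (\<Union>n\<in>\<int>. (\<lambda>a. n + a) ` A)"
    using assms by (intro open_UN ballI open_translation)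
  ultimately show ?thesis by (auto simp: openin_circle_iff)
qed

text \<open>The integers are closed in the reals, hence points are closed in the circle. This later
  separates characters of the dual.\<close>

lemma openin_circle_minus_point:
  "openin (group_topology circle_group) (carrier circle_group - {circle_of a})"
proof -
  have "{x. circle_of x \<in> carrier circle_group - {circle_of a}} = (\<lambda>x. x - a) -` (- \<int>)"
    by (auto simp: circle_of_eq_iff)
  moreover have "open ((\<lambda>x::real. x - a) -` (- \<int>))"
    by (intro open_vimage continuous_intros) (simp add: closed_Ints flip: closed_def)
  ultimately show ?thesis by (simp add: openin_circle_iff)
qed

text \<open>Around real representatives \<open>x\<close> and \<open>y\<close>, balls of half the
  radius add up into a given ball around \<open>x + y\<close>; their images are open because the
  quotient map is. The lemma makes pointwise products of characters continuous.\<close>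

lemma continuous_map_circle_mult:
  assumes f: "continuous_map S (group_topology circle_group) f"
    and g: "continuous_map S (group_topology circle_group) g"
  shows "continuous_map S (group_topology circle_group) (\<lambda>s. f s \<otimes>\<^bsub>circle_group\<^esub> g s)"
proof -
  have carr: "f s \<in> carrier circle_group" "g s \<in> carrier circle_group" if "s \<in> topspace S" for s
    using f g that by (auto simp: continuous_map_def topspace_circle)
  have "openin S {s \<in> topspace S. f s \<otimes>\<^bsub>circle_group\<^esub> g s \<in> W}"
    if W: "openin (group_topology circle_group) W" for W
  proof (subst openin_subopen, intro ballI)
    fix s assume "s \<in> {s \<in> topspace S. f s \<otimes>\<^bsub>circle_group\<^esub> g s \<in> W}"
    then have s: "s \<in> topspace S" "f s \<otimes>\<^bsub>circle_group\<^esub> g s \<in> W" by auto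
    obtain x y where xy: "f s = circle_of x" "g s = circle_of y"
      using carr[OF s(1)] by (meson circle_group_ex)
    have "open {x. circle_of x \<in> W}" "x + y \<in> {x. circle_of x \<in> W}"
      using W s(2) by (simp_all add: openin_circle_iff xy)
    then obtain e where e: "e > 0" "\<And>z. dist z (x + y) < e \<Longrightarrow> circle_of z \<in> W"
      unfolding open_dist by blast
    let ?A = "circle_of ` ball x (e/2)" and ?B = "circle_of ` ball y (e/2)"
    let ?T = "{s \<in> topspace S. f s \<in> ?A} \<inter> {s \<in> topspace S. g s \<in> ?B}"
    have "openin S ?T"
      by (intro openin_Int openin_continuous_map_preimage[OF f]
          openin_continuous_map_preimage[OF g] openin_circle_image) auto
    moreover have "s \<in> ?T"
      using s xy e(1) by auto
    moreover have "?T \<subseteq> {s \<in> topspace S. f s \<otimes>\<^bsub>circle_group\<^esub> g s \<in> W}"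
    proof
      fix r assume "r \<in> ?T"
      then obtain a b where r: "r \<in> topspace S" "f r = circle_of a" "g r = circle_of b"
        and "dist x a < e/2" "dist y b < e/2" by auto
      then have "dist (a + b) (x + y) < e"
        unfolding dist_real_def by linarith
      with e(2) r show "r \<in> {s \<in> topspace S. f s \<otimes>\<^bsub>circle_group\<^esub> g s \<in> W}" by simp
    qed
    ultimately show "\<exists>T. openin S T \<and> s \<in> T \<and> T \<subseteq> {s \<in> topspace S. f s \<otimes>\<^bsub>circle_group\<^esub> g s \<in> W}"
      by blast
  qed
  moreover have "f s \<otimes>\<^bsub>circle_group\<^esub> g s \<in> carrier circle_group" if s: "s \<in> topspace S" for s
  proof -
    obtain x y where "f s = circle_of x" "g s = circle_of y"
      using carr[OF s] by (meson circle_group_ex)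
    then show ?thesis by simp
  qed
  ultimately show ?thesis
    unfolding continuous_map_def topspace_circle by blast
qed

definition near_zero_arc :: "real \<Rightarrow> real set set" where
  "near_zero_arc \<epsilon> = circle_of ` {-\<epsilon><..<\<epsilon>}"

lemma openin_near_zero_arc: "openin (group_topology circle_group) (near_zero_arc \<epsilon>)"
  unfolding near_zero_arc_def by (intro openin_circle_image open_greaterThanLessThan)

lemma circle_of_in_near_zero_arc:
  "circle_of x \<in> near_zero_arc \<epsilon> \<longleftrightarrow> (\<exists>n\<in>\<int>. \<bar>x - n\<bar> < \<epsilon>)"
proof
  assume "circle_of x \<in> near_zero_arc \<epsilon>"
  then obtain r where "\<bar>r\<bar> < \<epsilon>" "x - r \<in> \<int>"
    by (force simp: near_zero_arc_def circle_of_eq_iff)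
  then show "\<exists>n\<in>\<int>. \<bar>x - n\<bar> < \<epsilon>" by (intro bexI[of _ "x - r"]) auto
next
  assume "\<exists>n\<in>\<int>. \<bar>x - n\<bar> < \<epsilon>"
  then obtain n where n: "n \<in> \<int>" "\<bar>x - n\<bar> < \<epsilon>" by blast
  then have "circle_of x = circle_of (x - n)" "x - n \<in> {-\<epsilon><..<\<epsilon>}"
    by (auto simp: circle_of_eq_iff)
  then show "circle_of x \<in> near_zero_arc \<epsilon>" unfolding near_zero_arc_def by blast
qed

text \<open>Meant for the value of a homomorphism at a neutral element: it is idempotent, and this
  identifies it without group axioms for the source.\<close>

lemma circle_idem_imp_zero:
  assumes "z \<in> carrier circle_group" "z \<otimes>\<^bsub>circle_group\<^esub> z = z"
  shows "z = circle_of 0"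
proof -
  from assms(1) obtain x where z: "z = circle_of x" using circle_group_ex by blast
  from assms(2) have "x \<in> \<int>" unfolding z by (simp only: circle_of_mult circle_of_eq_iff) simp
  then show ?thesis unfolding z circle_of_eq_iff by simp
qed

lemma int_circle_hom:
  fixes h :: "int \<Rightarrow> real set"
  assumes carr: "\<And>a. h a \<in> carrier circle_group"
    and add: "\<And>a b. h (a + b) = h a \<otimes>\<^bsub>circle_group\<^esub> h b" and one: "h 1 = circle_of t"
  shows "h c = circle_of (of_int c * t)"
proof -
  have 0: "h 0 = circle_of 0" using circle_idem_imp_zero[OF carr[of 0]] add[of 0 0] by simp
  have neg: "h (-1) = circle_of (- t)"
  proof -
    obtain s where s: "h (-1) = circle_of s" using carr by (meson circle_group_ex)
    have "circle_of (t + s) = circle_of 0" using add[of 1 "-1"] 0 s one by simp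
    then show ?thesis using s by (simp add: circle_of_eq_iff add.commute)
  qed
  show ?thesis
  proof (induction c rule: int_induct[of _ 0])
    case (step1 i)
    then show ?case using add[of i 1] one by (simp add: algebra_simps)
  next
    case (step2 i)
    then show ?case using add[of i "-1"] neg by (simp add: algebra_simps)
  qed (simp add: 0)
qed

text \<open>Any choice of real representatives of the values gives a function additive modulo
  integers, to which \<open>circle_character_lift\<close> applies. Triviality at 1 is periodicity:
  these are the characters of the circle, written on the line.\<close>

lemma circle_character:
  fixes h :: "real \<Rightarrow> real set"
  assumes carr: "\<And>a. h a \<in> carrier circle_group"
    and add: "\<And>a b. h (a + b) = h a \<otimes>\<^bsub>circle_group\<^esub> h b" and one: "h 1 = circle_of 0"
    and cont: "continuous_map euclideanreal (group_topology circle_group) h"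
  shows "\<exists>k::int. \<forall>t. h t = circle_of (of_int k * t)"
proof -
  have "\<exists>x. h t = circle_of x" for t
    by (rule circle_group_ex[OF carr])
  then obtain H where H: "\<And>t. h t = circle_of (H t)" by metis
  have h0: "h 0 = circle_of 0" using circle_idem_imp_zero[OF carr[of 0]] add[of 0 0] by simp
  have "open {t. h t \<in> near_zero_arc (1/6)}"
    using openin_continuous_map_preimage[OF cont openin_near_zero_arc, of "1/6"] by simp
  moreover have "0 \<in> {t. h t \<in> near_zero_arc (1/6)}"
    by (auto simp: h0 circle_of_in_near_zero_arc intro!: bexI[of _ 0])
  ultimately obtain \<delta> where \<delta>: "\<delta> > 0" "\<And>t. dist t 0 < \<delta> \<Longrightarrow> h t \<in> near_zero_arc (1/6)"
    unfolding open_dist by blast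
  have "\<exists>k::int. \<forall>t. H t - of_int k * t \<in> \<int>"
  proof (rule circle_character_lift[OF _ _ \<delta>(1)])
    show "H (s + t) - (H s + H t) \<in> \<int>" for s t
      using add[of s t] by (simp add: H circle_of_eq_iff)
    show "H 1 \<in> \<int>" using one by (simp add: H circle_of_eq_iff)
    show "\<exists>n\<in>\<int>. \<bar>H t - n\<bar> < 1/6" if "\<bar>t\<bar> < \<delta>" for t
      using \<delta>(2)[of t] that by (simp add: H circle_of_in_near_zero_arc)
  qed
  then show ?thesis by (simp add: H circle_of_eq_iff)
qed

section \<open>Pontryagin duals\<close>

lemma carrier_pontryagin_dual [simp]: "carrier (pontryagin_dual H) = characters H"
  by (simp add: pontryagin_dual_def monoid.defs)

lemma mult_pontryagin_dual:
  "\<xi> \<otimes>\<^bsub>pontryagin_dual H\<^esub> \<xi>' = (\<lambda>x\<in>carrier H. \<xi> x \<otimes>\<^bsub>circle_group\<^esub> \<xi>' x)"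
  by (simp add: pontryagin_dual_def monoid.defs hom_group_def)

lemma group_topology_pontryagin_dual:
  "group_topology (pontryagin_dual H) =
     compact_open_topology (group_topology H) (group_topology circle_group) (characters H)"
  by (simp add: pontryagin_dual_def monoid.defs top_group.defs)

lemma topspace_pontryagin_dual [simp]:
  "topspace (group_topology (pontryagin_dual H)) = characters H"
  by (simp add: group_topology_pontryagin_dual topspace_compact_open_topology)

lemma characters_iff:
  "\<xi> \<in> characters H \<longleftrightarrow> \<xi> \<in> hom H circle_group \<and> \<xi> \<in> extensional (carrier H) \<and>
     continuous_map (group_topology H) (group_topology circle_group) \<xi>"
  by (auto simp: characters_def hom_group_def)

lemma character_in_circle: "\<xi> \<in> characters H \<Longrightarrow> x \<in> carrier H \<Longrightarrow> \<xi> x \<in> carrier circle_group"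
  by (auto simp: characters_iff hom_def)

lemma character_mult:
  "\<xi> \<in> characters H \<Longrightarrow> x \<in> carrier H \<Longrightarrow> y \<in> carrier H \<Longrightarrow>
     \<xi> (x \<otimes>\<^bsub>H\<^esub> y) = \<xi> x \<otimes>\<^bsub>circle_group\<^esub> \<xi> y"
  by (simp add: characters_iff hom_def)

lemma characters_eqI:
  "\<xi> \<in> characters H \<Longrightarrow> \<xi>' \<in> characters H \<Longrightarrow> (\<And>x. x \<in> carrier H \<Longrightarrow> \<xi> x = \<xi>' x) \<Longrightarrow> \<xi> = \<xi>'"
  by (rule extensionalityI[of _ "carrier H"]) (auto simp: characters_iff)

lemma circle_mult_interchange:
  assumes "a \<in> carrier circle_group" "b \<in> carrier circle_group"
    "c \<in> carrier circle_group" "d \<in> carrier circle_group"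
  shows "(a \<otimes>\<^bsub>circle_group\<^esub> b) \<otimes>\<^bsub>circle_group\<^esub> (c \<otimes>\<^bsub>circle_group\<^esub> d) =
    (a \<otimes>\<^bsub>circle_group\<^esub> c) \<otimes>\<^bsub>circle_group\<^esub> (b \<otimes>\<^bsub>circle_group\<^esub> d)"
proof -
  obtain w x y z where "a = circle_of w" "b = circle_of x" "c = circle_of y" "d = circle_of z"
    using assms by (meson circle_group_ex)
  then show ?thesis by (simp add: algebra_simps)
qed

lemma circle_mult_closed:
  assumes "a \<in> carrier circle_group" "b \<in> carrier circle_group"
  shows "a \<otimes>\<^bsub>circle_group\<^esub> b \<in> carrier circle_group"
proof -
  obtain x y where "a = circle_of x" "b = circle_of y"
    using assms by (meson circle_group_ex)
  then show ?thesis by simp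
qed

lemma characters_mult_closed:
  assumes H: "topspace (group_topology H) = carrier H"
    and closed: "\<And>x y. x \<in> carrier H \<Longrightarrow> y \<in> carrier H \<Longrightarrow> x \<otimes>\<^bsub>H\<^esub> y \<in> carrier H"
    and \<xi>: "\<xi> \<in> characters H" and \<xi>': "\<xi>' \<in> characters H"
  shows "\<xi> \<otimes>\<^bsub>pontryagin_dual H\<^esub> \<xi>' \<in> characters H"
proof -
  have "continuous_map (group_topology H) (group_topology circle_group)
      (\<lambda>x. \<xi> x \<otimes>\<^bsub>circle_group\<^esub> \<xi>' x)"
    using \<xi> \<xi>' by (intro continuous_map_circle_mult) (auto simp: characters_iff)
  then have "continuous_map (group_topology H) (group_topology circle_group)
      (\<lambda>x\<in>carrier H. \<xi> x \<otimes>\<^bsub>circle_group\<^esub> \<xi>' x)"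
    by (rule continuous_map_eq) (simp add: H)
  moreover have "(\<lambda>x\<in>carrier H. \<xi> x \<otimes>\<^bsub>circle_group\<^esub> \<xi>' x) \<in> hom H circle_group"
  proof (rule homI)
    fix x y assume xy: "x \<in> carrier H" "y \<in> carrier H"
    show "(\<lambda>x\<in>carrier H. \<xi> x \<otimes>\<^bsub>circle_group\<^esub> \<xi>' x) (x \<otimes>\<^bsub>H\<^esub> y) =
      (\<lambda>x\<in>carrier H. \<xi> x \<otimes>\<^bsub>circle_group\<^esub> \<xi>' x) x \<otimes>\<^bsub>circle_group\<^esub>
      (\<lambda>x\<in>carrier H. \<xi> x \<otimes>\<^bsub>circle_group\<^esub> \<xi>' x) y"
      using xy closed[OF xy] \<xi> \<xi>'
      by (simp add: character_mult circle_mult_interchange character_in_circle)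
  qed (simp add: circle_mult_closed character_in_circle[OF \<xi>] character_in_circle[OF \<xi>'])
  ultimately show ?thesis
    by (simp add: characters_iff mult_pontryagin_dual)
qed

section \<open>The dual of the Baer-Specker group and its characters\<close>

definition specker_dual :: "((nat \<Rightarrow> int) \<Rightarrow> int) top_group" where
  "specker_dual = pointwise_hom_group baer_specker_group discrete_int_group"

lemma carrier_specker_dual: "carrier specker_dual = {f. additive_functional f}"
  by (simp add: specker_dual_def pointwise_hom_group_def monoid.defs hom_group_def
      hom_def baer_specker_group_def discrete_int_group_def additive_functional_def restrict_def)

lemma mult_specker_dual: "f \<otimes>\<^bsub>specker_dual\<^esub> g = (\<lambda>x. f x + g x)"
  by (simp add: specker_dual_def pointwise_hom_group_def monoid.defs hom_group_def
      baer_specker_group_def discrete_int_group_def integer_group_def restrict_def)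

lemma one_specker_dual: "\<one>\<^bsub>specker_dual\<^esub> = (\<lambda>x. 0)"
  by (simp add: specker_dual_def pointwise_hom_group_def monoid.defs hom_group_def
      baer_specker_group_def discrete_int_group_def integer_group_def restrict_def)

lemma group_topology_specker_dual:
  "group_topology specker_dual =
     subtopology (product_topology (\<lambda>_. discrete_topology UNIV) UNIV) (carrier specker_dual)"
  by (simp add: specker_dual_def pointwise_hom_group_def monoid.defs top_group.defs
      baer_specker_group_def discrete_int_group_def)

lemma topspace_specker_dual [simp]: "topspace (group_topology specker_dual) = carrier specker_dual"
  by (simp add: group_topology_specker_dual)

lemma specker_dual_mult_closed:
  "f \<in> carrier specker_dual \<Longrightarrow> g \<in> carrier specker_dual \<Longrightarrow> f \<otimes>\<^bsub>specker_dual\<^esub> g \<in> carrier specker_dual"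
  by (simp add: carrier_specker_dual mult_specker_dual additive_functional_def)

lemma group_specker_dual: "group specker_dual"
proof (rule groupI)
  fix f assume "f \<in> carrier specker_dual"
  then show "\<exists>g\<in>carrier specker_dual. g \<otimes>\<^bsub>specker_dual\<^esub> f = \<one>\<^bsub>specker_dual\<^esub>"
    by (intro bexI[of _ "\<lambda>x. - f x"])
      (auto simp: carrier_specker_dual mult_specker_dual one_specker_dual additive_functional_def)
qed (auto simp: carrier_specker_dual mult_specker_dual one_specker_dual additive_functional_def)

section \<open>Compact sets of functionals and neighbourhoods in the dual\<close>

lemma continuous_map_evaluation:
  "continuous_map (group_topology specker_dual) (discrete_topology UNIV) (\<lambda>f. f x)"
  unfolding group_topology_specker_dual
  by (intro continuous_map_from_subtopology continuous_map_product_projection) simp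

text \<open>Evaluation is continuous into the discrete integers, whose compact subsets are
  finite.\<close>

lemma finite_evaluation_compactin:
  assumes "compactin (group_topology specker_dual) C"
  shows "finite ((\<lambda>f. f x) ` C)"
  using image_compactin[OF assms continuous_map_evaluation] by (simp add: compactin_discrete_topology)

text \<open>By \<open>specker_sum\<close> this is the free abelian group on the first
  \<open>m\<close> coordinate projections. Every functional lies in one of these groups.\<close>

definition supported_below :: "nat \<Rightarrow> ((nat \<Rightarrow> int) \<Rightarrow> int) set" where
  "supported_below m = {f \<in> carrier specker_dual. \<forall>n\<ge>m. f (unit_seq n) = 0}"

lemma compactin_specker_dual_supported_below:
  assumes "compactin (group_topology specker_dual) C"
  shows "\<exists>m. C \<subseteq> supported_below m"
proof -
  have C: "C \<subseteq> carrier specker_dual" using compactin_subset_topspace[OF assms] by simp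
  then have "\<exists>m. \<forall>f\<in>C. \<forall>n\<ge>m. f (unit_seq n) = 0"
    by (intro pointwise_finite_imp_common_support finite_evaluation_compactin[OF assms])
      (auto simp: carrier_specker_dual)
  with C show ?thesis by (auto simp: supported_below_def)
qed

lemma supported_below_mono: "m \<le> n \<Longrightarrow> supported_below m \<subseteq> supported_below n"
  by (auto simp: supported_below_def)

text \<open>A subbasic set restricts values on a compact set only, which lies in some
  \<open>supported_below m\<close>. For an intersection take the larger bound, for a union that of a
  member containing \<open>\<theta>\<close>.\<close>

lemma dual_nhd_determined_by_supported_below:
  assumes "openin (group_topology (pontryagin_dual specker_dual)) W" "\<theta> \<in> W"
  shows "\<exists>m. \<forall>\<xi>\<in>characters specker_dual. (\<forall>f\<in>supported_below m. \<xi> f = \<theta> f) \<longrightarrow> \<xi> \<in> W"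
proof -
  let ?B = "{{f \<in> characters specker_dual. f ` K \<subseteq> U} | K U.
    compactin (group_topology specker_dual) K \<and> openin (group_topology circle_group) U}"
  have "generate_topology_on ?B W"
    using assms(1) unfolding group_topology_pontryagin_dual compact_open_topology_def
    by (rule openin_topology_generated_by)
  then show ?thesis using assms(2)
  proof induction
    case (Int V W)
    then obtain m n where
      mn: "\<forall>\<xi>\<in>characters specker_dual. (\<forall>f\<in>supported_below m. \<xi> f = \<theta> f) \<longrightarrow> \<xi> \<in> V"
        "\<forall>\<xi>\<in>characters specker_dual. (\<forall>f\<in>supported_below n. \<xi> f = \<theta> f) \<longrightarrow> \<xi> \<in> W"
      by blast
    have sub: "supported_below m \<subseteq> supported_below (max m n)"
        "supported_below n \<subseteq> supported_below (max m n)"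
      by (auto intro!: supported_below_mono)
    show ?case
    proof (intro exI[of _ "max m n"] ballI impI IntI)
      fix \<xi> assume \<xi>: "\<xi> \<in> characters specker_dual" "\<forall>f\<in>supported_below (max m n). \<xi> f = \<theta> f"
      show "\<xi> \<in> V" using \<xi> sub(1) by (intro mn(1)[rule_format]) auto
      show "\<xi> \<in> W" using \<xi> sub(2) by (intro mn(2)[rule_format]) auto
    qed
  next
    case (UN \<K>)
    then obtain V where V: "V \<in> \<K>" "\<theta> \<in> V" by blast
    from UN.IH[OF this] obtain m where
      "\<forall>\<xi>\<in>characters specker_dual. (\<forall>f\<in>supported_below m. \<xi> f = \<theta> f) \<longrightarrow> \<xi> \<in> V" ..
    with V show ?case by blast
  next
    case (Basis S)
    then obtain K U where K: "compactin (group_topology specker_dual) K"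
      and S: "S = {f \<in> characters specker_dual. f ` K \<subseteq> U}" by blast
    from compactin_specker_dual_supported_below[OF K] obtain m where m: "K \<subseteq> supported_below m" ..
    have "\<xi> \<in> S" if "\<xi> \<in> characters specker_dual" "\<forall>f\<in>supported_below m. \<xi> f = \<theta> f" for \<xi>
      using that m Basis.prems unfolding S by (auto simp: subset_iff image_iff)
    then show ?case by blast
  qed simp
qed

section \<open>Circles of characters and compact crosses in the dual\<close>

definition line_character :: "nat \<Rightarrow> real \<Rightarrow> ((nat \<Rightarrow> int) \<Rightarrow> int) \<Rightarrow> real set" where
  "line_character n t = (\<lambda>f\<in>carrier specker_dual. circle_of (t * of_int (f (unit_seq n))))"

lemma line_character_in_characters: "line_character n t \<in> characters specker_dual"
  unfolding characters_iff
proof (intro conjI)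
  show "line_character n t \<in> hom specker_dual circle_group"
    using specker_dual_mult_closed
    by (intro homI) (auto simp: line_character_def mult_specker_dual algebra_simps)
  have "continuous_map (discrete_topology UNIV) (group_topology circle_group)
      (\<lambda>a::int. circle_of (t * of_int a))"
    by (simp add: continuous_map_from_discrete_topology topspace_circle)
  from continuous_map_compose[OF continuous_map_evaluation[of "unit_seq n"] this]
  show "continuous_map (group_topology specker_dual) (group_topology circle_group) (line_character n t)"
    by (rule continuous_map_eq) (simp add: line_character_def)
qed (simp add: line_character_def)

definition trivial_character :: "((nat \<Rightarrow> int) \<Rightarrow> int) \<Rightarrow> real set" where
  "trivial_character = (\<lambda>f\<in>carrier specker_dual. circle_of 0)"

lemma trivial_character: "f \<in> carrier specker_dual \<Longrightarrow> trivial_character f = circle_of 0"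
  by (simp add: trivial_character_def)

lemma line_character_add:
  "line_character n (s + t) =
     line_character n s \<otimes>\<^bsub>pontryagin_dual specker_dual\<^esub> line_character n t"
  by (auto simp: line_character_def mult_pontryagin_dual fun_eq_iff algebra_simps)

lemma line_character_0: "line_character n 0 = trivial_character"
  by (simp add: line_character_def trivial_character_def)

lemma line_character_1: "line_character n 1 = trivial_character"
  by (auto simp: line_character_def trivial_character_def fun_eq_iff circle_of_eq_iff)

lemma trivial_character_in_characters: "trivial_character \<in> characters specker_dual"
  using line_character_in_characters[of 0 0] by (simp add: line_character_0)

text \<open>On a compact set the \<open>n\<close>-th coordinate takes finitely many values, so the
  preimage of a subbasic set is a finite intersection of open sets of reals.\<close>

lemma continuous_map_line_character:
  "continuous_map euclideanreal (group_topology (pontryagin_dual specker_dual)) (line_character n)"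
  unfolding group_topology_pontryagin_dual compact_open_topology_def
proof (rule continuous_on_generated_topo)
  let ?B = "{{f \<in> characters specker_dual. f ` K \<subseteq> U} | K U.
    compactin (group_topology specker_dual) K \<and> openin (group_topology circle_group) U}"
  show "line_character n ` topspace euclideanreal \<subseteq> \<Union>?B"
    using topspace_compact_open_topology[of "group_topology specker_dual"
        "group_topology circle_group" "characters specker_dual"]
    unfolding compact_open_topology_def topology_generated_by_topspace
    by (auto simp: line_character_in_characters)
  fix S assume "S \<in> ?B"
  then obtain K U where K: "compactin (group_topology specker_dual) K"
    and U: "openin (group_topology circle_group) U"
    and S: "S = {f \<in> characters specker_dual. f ` K \<subseteq> U}" by blast
  have Kc: "K \<subseteq> carrier specker_dual" using compactin_subset_topspace[OF K] by simp
  have "line_character n t f = circle_of (t * of_int (f (unit_seq n)))" if "f \<in> K" for t f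
    using that Kc by (auto simp: line_character_def)
  then have "line_character n -` S = (\<Inter>a\<in>(\<lambda>f. f (unit_seq n)) ` K. {t. circle_of (t * of_int a) \<in> U})"
    unfolding S by (auto simp: line_character_in_characters)
  moreover have "open {t. circle_of (t * of_int a) \<in> U}" for a
  proof -
    have "open ((\<lambda>t. t * of_int a) -` {x. circle_of x \<in> U})"
      using U by (intro open_vimage continuous_intros) (simp add: openin_circle_iff)
    then show ?thesis by (simp add: vimage_def)
  qed
  then have "open (\<Inter>a\<in>(\<lambda>f. f (unit_seq n)) ` K. {t. circle_of (t * of_int a) \<in> U})"
    by (intro open_INT finite_evaluation_compactin[OF K]) blast
  ultimately show "openin euclideanreal (line_character n -` S \<inter> topspace euclideanreal)"
    by simp
qed

text \<open>A member of the cover that contains \<open>p\<close> swallows all but finitely many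
  \<open>K n\<close>; the remaining ones form a finite union of compact sets.\<close>

lemma compactin_null_sequence:
  assumes p: "p \<in> topspace X" and K: "\<And>n::nat. compactin X (K n)"
    and null: "\<And>W. openin X W \<Longrightarrow> p \<in> W \<Longrightarrow> \<exists>m. \<forall>n\<ge>m. K n \<subseteq> W"
  shows "compactin X (insert p (\<Union>n. K n))"
  unfolding compactin_def
proof (intro conjI allI impI)
  show "insert p (\<Union>n. K n) \<subseteq> topspace X"
    using p compactin_subset_topspace[OF K] by blast
next
  fix \<U> assume U: "(\<forall>U\<in>\<U>. openin X U) \<and> insert p (\<Union>n. K n) \<subseteq> \<Union>\<U>"
  then obtain W where W: "W \<in> \<U>" "p \<in> W" by blast
  with U null obtain m where m: "\<And>n. n \<ge> m \<Longrightarrow> K n \<subseteq> W" by metis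
  have "compactin X (\<Union>(K ` {..<m}))"
    using K by (intro compactin_Union) auto
  moreover have "\<Union>(K ` {..<m}) \<subseteq> \<Union>\<U>" using U by blast
  ultimately obtain \<F> where F: "finite \<F>" "\<F> \<subseteq> \<U>" "\<Union>(K ` {..<m}) \<subseteq> \<Union>\<F>"
    using U unfolding compactin_def by meson
  have "insert p (\<Union>n. K n) \<subseteq> \<Union>(insert W \<F>)"
  proof -
    have "K n \<subseteq> \<Union>(insert W \<F>)" for n
      using m[of n] F(3) by (cases "n < m") auto
    with W show ?thesis by blast
  qed
  with F W show "\<exists>\<F>. finite \<F> \<and> \<F> \<subseteq> \<U> \<and> insert p (\<Union>n. K n) \<subseteq> \<Union>\<F>"
    by (intro exI[of _ "insert W \<F>"]) auto
qed

definition cross :: "(nat \<Rightarrow> real) \<Rightarrow> (((nat \<Rightarrow> int) \<Rightarrow> int) \<Rightarrow> real set) set" where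
  "cross c = insert trivial_character (\<Union>n. line_character n ` {-c n..c n})"

text \<open>For \<open>n \<ge> m\<close> a line character is trivial on
  \<open>supported_below m\<close>, whatever its parameter. So the arms converge to the trivial
  character for every choice of lengths \<open>c\<close>.\<close>

lemma compactin_cross: "compactin (group_topology (pontryagin_dual specker_dual)) (cross c)"
  unfolding cross_def
proof (rule compactin_null_sequence)
  show "compactin (group_topology (pontryagin_dual specker_dual)) (line_character n ` {- c n..c n})" for n
    by (intro image_compactin[OF _ continuous_map_line_character]) simp
  fix W assume "openin (group_topology (pontryagin_dual specker_dual)) W" "trivial_character \<in> W"
  from dual_nhd_determined_by_supported_below[OF this] obtain m
    where m: "\<forall>\<xi>\<in>characters specker_dual.
      (\<forall>f\<in>supported_below m. \<xi> f = trivial_character f) \<longrightarrow> \<xi> \<in> W" ..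
  have "line_character n t \<in> W" if "n \<ge> m" for n t
    by (rule m[rule_format, OF line_character_in_characters])
      (use that in \<open>auto simp: line_character_def supported_below_def trivial_character\<close>)
  then show "\<exists>m. \<forall>n\<ge>m. line_character n ` {- c n..c n} \<subseteq> W" by blast
qed (simp add: trivial_character_in_characters)

section \<open>The second dual\<close>

definition evaluation_character ::
    "((nat \<Rightarrow> int) \<Rightarrow> int) \<Rightarrow> (((nat \<Rightarrow> int) \<Rightarrow> int) \<Rightarrow> real set) \<Rightarrow> real set" where
  "evaluation_character f = (\<lambda>\<xi>\<in>characters specker_dual. \<xi> f)"

lemma dual_mult_closed:
  "\<xi> \<in> characters specker_dual \<Longrightarrow> \<xi>' \<in> characters specker_dual \<Longrightarrow>
     \<xi> \<otimes>\<^bsub>pontryagin_dual specker_dual\<^esub> \<xi>' \<in> characters specker_dual"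
  by (intro characters_mult_closed specker_dual_mult_closed) auto

lemma openin_compact_open_dual:
  assumes "compactin (group_topology H) K" "openin (group_topology circle_group) U"
  shows "openin (group_topology (pontryagin_dual H)) {\<xi> \<in> characters H. \<xi> ` K \<subseteq> U}"
  unfolding group_topology_pontryagin_dual compact_open_topology_def
  using assms by (intro topology_generated_by_Basis CollectI exI[of _ K] exI[of _ U]) simp

text \<open>Continuity holds because singletons are compact: the preimage of an open set is itself a
  subbasic set of the dual.\<close>

lemma evaluation_character_in_bidual:
  assumes f: "f \<in> carrier specker_dual"
  shows "evaluation_character f \<in> characters (pontryagin_dual specker_dual)"
  unfolding characters_iff
proof (intro conjI)
  show "evaluation_character f \<in> hom (pontryagin_dual specker_dual) circle_group"
    using f dual_mult_closed
    by (intro homI) (auto simp: evaluation_character_def mult_pontryagin_dual character_in_circle)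
  show "evaluation_character f \<in> extensional (carrier (pontryagin_dual specker_dual))"
    by (simp add: evaluation_character_def)
  have "openin (group_topology (pontryagin_dual specker_dual))
      {\<xi> \<in> characters specker_dual. evaluation_character f \<xi> \<in> U}"
    if U: "openin (group_topology circle_group) U" for U
  proof -
    have "compactin (group_topology specker_dual) {f}" using f by simp
    from openin_compact_open_dual[OF this U] show ?thesis
      by (rule back_subst) (auto simp: evaluation_character_def)
  qed
  then show "continuous_map (group_topology (pontryagin_dual specker_dual))
      (group_topology circle_group) (evaluation_character f)"
    unfolding continuous_map_def using f
    by (auto simp: topspace_circle evaluation_character_def character_in_circle)
qed

lemma line_character_separates:
  assumes "f \<in> carrier specker_dual" "g \<in> carrier specker_dual" "f \<noteq> g"
  shows "\<exists>n t. line_character n t f \<noteq> line_character n t g"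
proof -
  obtain n where n: "f (unit_seq n) \<noteq> g (unit_seq n)"
    using assms additive_functional_eqI[of f g] by (auto simp: carrier_specker_dual)
  define d where "d = f (unit_seq n) - g (unit_seq n)"
  \<comment> \<open>With this parameter the two values differ by 1/2 before passing to the circle,
    hence remain different there.\<close>
  define t where "t = 1 / (2 * real_of_int d)"
  have "t * of_int (f (unit_seq n)) - t * of_int (g (unit_seq n)) = t * of_int d"
    by (simp add: d_def algebra_simps)
  also have "\<dots> = 1/2" using n by (simp add: d_def t_def)
  also have "1/2 \<notin> (\<int> :: real set)"
  proof
    assume "1/2 \<in> (\<int> :: real set)"
    then obtain k :: int where "1/2 = real_of_int k" by (elim Ints_cases)
    then have "real_of_int (2 * k) = real_of_int 1" by simp
    then have "2 * k = 1" by (simp only: of_int_eq_iff)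
    then show False by presburger
  qed
  finally show ?thesis
    using assms by (intro exI[of _ n] exI[of _ t]) (simp add: line_character_def circle_of_eq_iff)
qed

lemma inj_on_evaluation_character: "inj_on evaluation_character (carrier specker_dual)"
proof (rule inj_onI, rule ccontr)
  fix f g assume fg: "f \<in> carrier specker_dual" "g \<in> carrier specker_dual"
    and eq: "evaluation_character f = evaluation_character g" and "f \<noteq> g"
  then obtain n t where "line_character n t f \<noteq> line_character n t g"
    using line_character_separates by blast
  with eq line_character_in_characters[of n t] show False
    unfolding evaluation_character_def by (metis restrict_apply')
qed

section \<open>Every character of the dual is an evaluation\<close>

definition linear_functional :: "(nat \<Rightarrow> int) \<Rightarrow> nat \<Rightarrow> (nat \<Rightarrow> int) \<Rightarrow> int" where
  "linear_functional a m = (\<lambda>x. \<Sum>n<m. a n * x n)"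

lemma linear_functional_in_carrier: "linear_functional a m \<in> carrier specker_dual"
  by (simp add: linear_functional_def carrier_specker_dual additive_functional_def
      algebra_simps sum.distrib)

lemma supported_below_eq_linear_functional:
  assumes "f \<in> supported_below m"
  shows "f = linear_functional (\<lambda>n. f (unit_seq n)) m"
  unfolding linear_functional_def
  by (rule ext, rule specker_sum)
    (use assms in \<open>auto simp: supported_below_def carrier_specker_dual\<close>)

text \<open>Induction on the number of terms: a character is determined on finite combinations by
  its values on the coordinate projections. The reals \<open>t n\<close> represent these
  values.\<close>

lemma character_linear_functional:
  assumes \<xi>: "\<xi> \<in> characters specker_dual" and t: "\<And>n. \<xi> (\<lambda>x. x n) = circle_of (t n)"
  shows "\<xi> (linear_functional a m) = circle_of (\<Sum>n<m. of_int (a n) * t n)"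
proof (induction m)
  have mem: "(\<lambda>x. c * x n) \<in> carrier specker_dual" for c n
    by (simp add: carrier_specker_dual additive_functional_def algebra_simps)
  have scale: "\<xi> (\<lambda>x. c * x n) = circle_of (of_int c * t n)" for c n
  proof (rule int_circle_hom[of "\<lambda>c. \<xi> (\<lambda>x. c * x n)"])
    show "\<xi> (\<lambda>x. a * x n) \<in> carrier circle_group" for a
      by (rule character_in_circle[OF \<xi> mem])
    show "\<xi> (\<lambda>x. (a + b) * x n) = \<xi> (\<lambda>x. a * x n) \<otimes>\<^bsub>circle_group\<^esub> \<xi> (\<lambda>x. b * x n)" for a b
      using character_mult[OF \<xi> mem mem, of a n b n] by (simp add: mult_specker_dual algebra_simps)
  qed (simp add: t)
  {
    case 0
    show ?case using scale[of 0] by (simp add: linear_functional_def)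
  next
    case (Suc m)
    have "linear_functional a (Suc m) = linear_functional a m \<otimes>\<^bsub>specker_dual\<^esub> (\<lambda>x. a m * x m)"
      by (simp add: linear_functional_def mult_specker_dual)
    then show ?case
      using character_mult[OF \<xi> linear_functional_in_carrier mem] Suc scale by simp
  }
qed

text \<open>A finite sum of line characters. Its value at the \<open>n\<close>-th coordinate
  projection is \<open>circle_of (t n)\<close> for \<open>n < m\<close>, so it realises arbitrary
  values on the first \<open>m\<close> projections.\<close>

definition torus_character :: "(nat \<Rightarrow> real) \<Rightarrow> nat \<Rightarrow> ((nat \<Rightarrow> int) \<Rightarrow> int) \<Rightarrow> real set" where
  "torus_character t m =
     (\<lambda>f\<in>carrier specker_dual. circle_of (\<Sum>n<m. t n * of_int (f (unit_seq n))))"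

lemma torus_character_0: "torus_character t 0 = trivial_character"
  by (simp add: torus_character_def trivial_character_def)

lemma torus_character_Suc:
  "torus_character t (Suc m) =
     torus_character t m \<otimes>\<^bsub>pontryagin_dual specker_dual\<^esub> line_character m (t m)"
  by (auto simp: torus_character_def line_character_def mult_pontryagin_dual fun_eq_iff)

lemma torus_character_in_characters: "torus_character t m \<in> characters specker_dual"
  by (induction m)
    (auto simp: torus_character_0 torus_character_Suc trivial_character_in_characters
      line_character_in_characters dual_mult_closed)

text \<open>Along the path \<open>line_character n\<close>, which closes up at parameter 1,
  \<open>\<psi>\<close> becomes a continuous homomorphism from the reals that is trivial at 1. Its
  degree is \<open>k\<close>.\<close>

lemma bidual_eval_line_character:
  assumes \<psi>: "\<psi> \<in> characters (pontryagin_dual specker_dual)"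
  shows "\<exists>k::int. \<forall>t. \<psi> (line_character n t) = circle_of (of_int k * t)"
proof (rule circle_character)
  have mult: "\<psi> (line_character n (s + t)) =
      \<psi> (line_character n s) \<otimes>\<^bsub>circle_group\<^esub> \<psi> (line_character n t)" for s t
    unfolding line_character_add
    by (rule character_mult[OF \<psi>]) (simp_all add: line_character_in_characters)
  show carr: "\<psi> (line_character n t) \<in> carrier circle_group" for t
    by (rule character_in_circle[OF \<psi>]) (simp add: line_character_in_characters)
  show "\<psi> (line_character n (s + t)) =
      \<psi> (line_character n s) \<otimes>\<^bsub>circle_group\<^esub> \<psi> (line_character n t)" for s t
    by (rule mult)
  have "\<psi> trivial_character = circle_of 0"
    using circle_idem_imp_zero[OF carr[of 0]] mult[of 0 0] by (simp add: line_character_0)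
  then show "\<psi> (line_character n 1) = circle_of 0" by (simp add: line_character_1)
  have "continuous_map (group_topology (pontryagin_dual specker_dual)) (group_topology circle_group) \<psi>"
    using \<psi> by (simp add: characters_iff)
  from continuous_map_compose[OF continuous_map_line_character this]
  show "continuous_map euclideanreal (group_topology circle_group) (\<lambda>t. \<psi> (line_character n t))"
    by (simp add: comp_def)
qed

text \<open>The circle has no small subgroups, so \<open>\<psi>\<close> kills a subgroup that it maps into a short arc.\<close>

lemma bidual_trivial_on_subgroup:
  assumes \<psi>: "\<psi> \<in> characters (pontryagin_dual specker_dual)"
  shows "\<exists>m. \<forall>\<xi>\<in>characters specker_dual.
    (\<forall>f\<in>supported_below m. \<xi> f = circle_of 0) \<longrightarrow> \<psi> \<xi> = circle_of 0"
proof -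
  let ?W = "{\<xi> \<in> characters specker_dual. \<psi> \<xi> \<in> near_zero_arc (1/3)}"
  have "openin (group_topology (pontryagin_dual specker_dual)) ?W"
    using openin_continuous_map_preimage[OF _ openin_near_zero_arc, of
        "group_topology (pontryagin_dual specker_dual)" \<psi> "1/3"] \<psi>
    by (simp add: characters_iff)
  moreover have "trivial_character \<in> ?W"
  proof -
    obtain k :: int where "\<And>t. \<psi> (line_character 0 t) = circle_of (of_int k * t)"
      using bidual_eval_line_character[OF \<psi>, of 0] by blast
    from this[of 0] show ?thesis
      by (auto simp: line_character_0 trivial_character_in_characters circle_of_in_near_zero_arc
          intro!: bexI[of _ 0])
  qed
  ultimately have "\<exists>m. \<forall>\<xi>\<in>characters specker_dual.
      (\<forall>f\<in>supported_below m. \<xi> f = trivial_character f) \<longrightarrow> \<xi> \<in> ?W"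
    by (rule dual_nhd_determined_by_supported_below)
  then obtain m where m: "\<forall>\<xi>\<in>characters specker_dual.
      (\<forall>f\<in>supported_below m. \<xi> f = trivial_character f) \<longrightarrow> \<xi> \<in> ?W" ..
  have "\<psi> \<xi> = circle_of 0"
    if \<xi>: "\<xi> \<in> characters specker_dual" "\<forall>f\<in>supported_below m. \<xi> f = circle_of 0" for \<xi>
  proof -
    obtain s where s: "\<psi> \<xi> = circle_of s"
      using circle_group_ex[OF character_in_circle[OF \<psi>, of \<xi>]] \<xi>(1) by auto
    \<comment> \<open>Repeated doubling of \<open>\<xi>\<close> stays in the subgroup of characters
      trivial on \<open>supported_below m\<close>, hence in \<open>?W\<close>. So all doublings of
      \<open>s\<close> are within 1/3 of an integer.\<close>
    define P where "P i = ((\<lambda>\<zeta>. \<zeta> \<otimes>\<^bsub>pontryagin_dual specker_dual\<^esub> \<zeta>) ^^ i) \<xi>" for i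
    have P: "P i \<in> characters specker_dual \<and> (\<forall>f\<in>supported_below m. P i f = circle_of 0) \<and>
        \<psi> (P i) = circle_of (2 ^ i * s)" for i
    proof (induction i)
      case 0
      then show ?case using \<xi> s by (simp add: P_def)
    next
      case (Suc i)
      have Suc_eq: "P (Suc i) = P i \<otimes>\<^bsub>pontryagin_dual specker_dual\<^esub> P i"
        by (simp add: P_def)
      have "\<psi> (P (Suc i)) = \<psi> (P i) \<otimes>\<^bsub>circle_group\<^esub> \<psi> (P i)"
        unfolding Suc_eq by (rule character_mult[OF \<psi>]) (simp_all add: Suc)
      moreover have "P (Suc i) f = circle_of 0" if "f \<in> supported_below m" for f
      proof -
        have "f \<in> carrier specker_dual" using that by (simp add: supported_below_def)
        with that Suc show ?thesis by (simp add: Suc_eq mult_pontryagin_dual)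
      qed
      moreover have "P (Suc i) \<in> characters specker_dual"
        unfolding Suc_eq using Suc by (intro dual_mult_closed) auto
      ultimately show ?case using Suc by (simp add: mult_ac)
    qed
    have "s \<in> \<int>"
    proof (rule Ints_if_doublings_near_Ints)
      fix i
      have "P i \<in> ?W"
        using P[of i] by (intro m[rule_format]) (auto simp: supported_below_def trivial_character)
      then show "\<exists>n\<in>\<int>. \<bar>2 ^ i * s - n\<bar> < 1/3"
        using P[of i] by (simp add: circle_of_in_near_zero_arc)
    qed
    then show ?thesis by (simp add: s circle_of_eq_iff)
  qed
  then show ?thesis by blast
qed

text \<open>On the subgroup generated by the line characters \<open>\<psi>\<close> is known from its
  degrees \<open>k n\<close>. An arbitrary \<open>\<xi>\<close> differs from an element of that
  subgroup by a character that is trivial on \<open>supported_below m\<close>, which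
  \<open>\<psi>\<close> kills.\<close>

lemma bidual_is_evaluation:
  assumes \<psi>: "\<psi> \<in> characters (pontryagin_dual specker_dual)"
  shows "\<exists>f\<in>carrier specker_dual. \<psi> = evaluation_character f"
proof -
  have "\<exists>k::int. \<forall>t. \<psi> (line_character n t) = circle_of (of_int k * t)" for n
    by (rule bidual_eval_line_character[OF \<psi>])
  then obtain k :: "nat \<Rightarrow> int"
    where k: "\<And>n t. \<psi> (line_character n t) = circle_of (of_int (k n) * t)" by metis
  have torus: "\<psi> (torus_character t m) = circle_of (\<Sum>n<m. of_int (k n) * t n)" for t m
  proof (induction m)
    case 0
    then show ?case using k[of 0 0] by (simp add: torus_character_0 line_character_0)
  next
    case (Suc m)
    have "\<psi> (torus_character t (Suc m)) =
        \<psi> (torus_character t m) \<otimes>\<^bsub>circle_group\<^esub> \<psi> (line_character m (t m))"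
      unfolding torus_character_Suc
      by (rule character_mult[OF \<psi>])
        (simp_all add: torus_character_in_characters line_character_in_characters)
    with Suc show ?case by (simp add: k)
  qed
  from bidual_trivial_on_subgroup[OF \<psi>] obtain m where m: "\<forall>\<xi>\<in>characters specker_dual.
      (\<forall>f\<in>supported_below m. \<xi> f = circle_of 0) \<longrightarrow> \<psi> \<xi> = circle_of 0" ..
  \<comment> \<open>Cutting off at \<open>m\<close> loses no degree: line characters with
    \<open>n \<ge> m\<close> are trivial on \<open>supported_below m\<close>, so
    \<open>\<psi>\<close> kills them and \<open>k n = 0\<close>.\<close>
  define f where "f = linear_functional k m"
  have "\<psi> \<xi> = evaluation_character f \<xi>" if \<xi>: "\<xi> \<in> characters specker_dual" for \<xi>
  proof -
    have "\<exists>t. \<xi> (\<lambda>x. x n) = circle_of t" for n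
      by (intro circle_group_ex character_in_circle[OF \<xi>])
        (simp add: carrier_specker_dual additive_functional_def)
    then obtain t where t: "\<And>n. \<xi> (\<lambda>x. x n) = circle_of (t n)" by metis
    \<comment> \<open>Cancels \<open>\<xi>\<close> on the first \<open>m\<close> coordinate
      projections, so that the product is trivial on \<open>supported_below m\<close>.\<close>
    define \<theta> where "\<theta> = torus_character (\<lambda>n. - t n) m"
    have \<theta>: "\<theta> \<in> characters specker_dual"
      by (simp add: \<theta>_def torus_character_in_characters)
    have "(\<xi> \<otimes>\<^bsub>pontryagin_dual specker_dual\<^esub> \<theta>) g = circle_of 0" if g: "g \<in> supported_below m" for g
    proof -
      have gc: "g \<in> carrier specker_dual" using g by (simp add: supported_below_def)
      have "\<xi> g = circle_of (\<Sum>n<m. of_int (g (unit_seq n)) * t n)"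
        by (subst supported_below_eq_linear_functional[OF g])
          (rule character_linear_functional[OF \<xi> t])
      with gc show ?thesis
        by (simp add: mult_pontryagin_dual \<theta>_def torus_character_def sum_negf mult.commute)
    qed
    then have "\<psi> (\<xi> \<otimes>\<^bsub>pontryagin_dual specker_dual\<^esub> \<theta>) = circle_of 0"
      using \<xi> \<theta> by (intro m[rule_format] dual_mult_closed) auto
    moreover have "\<psi> (\<xi> \<otimes>\<^bsub>pontryagin_dual specker_dual\<^esub> \<theta>) = \<psi> \<xi> \<otimes>\<^bsub>circle_group\<^esub> \<psi> \<theta>"
      using \<xi> \<theta> by (intro character_mult[OF \<psi>]) auto
    moreover have "\<psi> \<theta> = circle_of (- (\<Sum>n<m. of_int (k n) * t n))"
      by (simp add: \<theta>_def torus sum_negf)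
    moreover obtain s where s: "\<psi> \<xi> = circle_of s"
      using circle_group_ex[OF character_in_circle[OF \<psi>, of \<xi>]] \<xi> by auto
    ultimately have "\<psi> \<xi> = circle_of (\<Sum>n<m. of_int (k n) * t n)"
      by (simp add: circle_of_eq_iff)
    also have "\<dots> = \<xi> f"
      unfolding f_def by (rule character_linear_functional[OF \<xi> t, symmetric])
    finally show ?thesis using \<xi> by (simp add: evaluation_character_def)
  qed
  moreover have "f \<in> carrier specker_dual"
    by (simp add: f_def linear_functional_in_carrier)
  ultimately show ?thesis
    using characters_eqI[OF \<psi> evaluation_character_in_bidual] by auto
qed

lemma bidual_eq_evaluations:
  "characters (pontryagin_dual specker_dual) = evaluation_character ` carrier specker_dual"
proof
  show "characters (pontryagin_dual specker_dual) \<subseteq> evaluation_character ` carrier specker_dual"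
  proof
    fix \<psi> assume "\<psi> \<in> characters (pontryagin_dual specker_dual)"
    from bidual_is_evaluation[OF this] obtain f
      where "f \<in> carrier specker_dual" "\<psi> = evaluation_character f" ..
    then show "\<psi> \<in> evaluation_character ` carrier specker_dual" by simp
  qed
qed (rule image_subsetI, rule evaluation_character_in_bidual)

lemma evaluation_character_iso:
  "evaluation_character \<in> iso specker_dual (pontryagin_dual (pontryagin_dual specker_dual))"
proof (rule isoI)
  show "evaluation_character \<in> hom specker_dual (pontryagin_dual (pontryagin_dual specker_dual))"
  proof (rule homI)
    fix f g assume fg: "f \<in> carrier specker_dual" "g \<in> carrier specker_dual"
    have "\<xi> (f \<otimes>\<^bsub>specker_dual\<^esub> g) =
        evaluation_character f \<xi> \<otimes>\<^bsub>circle_group\<^esub> evaluation_character g \<xi>"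
      if "\<xi> \<in> characters specker_dual" for \<xi>
      using character_mult[OF that fg] that by (simp add: evaluation_character_def)
    then show "evaluation_character (f \<otimes>\<^bsub>specker_dual\<^esub> g) = evaluation_character f
        \<otimes>\<^bsub>pontryagin_dual (pontryagin_dual specker_dual)\<^esub> evaluation_character g"
      unfolding mult_pontryagin_dual carrier_pontryagin_dual
        evaluation_character_def[of "f \<otimes>\<^bsub>specker_dual\<^esub> g"]
      by (rule restrict_ext)
  qed (simp add: evaluation_character_in_bidual)
  show "bij_betw evaluation_character (carrier specker_dual)
      (carrier (pontryagin_dual (pontryagin_dual specker_dual)))"
    using inj_on_evaluation_character
    unfolding bij_betw_def carrier_pontryagin_dual bidual_eq_evaluations by simp
qed

section \<open>Discreteness of the second dual\<close>

lemma small_arc_bound: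
  fixes a :: int
  assumes c: "c > 0" and arc: "\<And>t. \<bar>t\<bar> \<le> c \<Longrightarrow> \<exists>n\<in>\<int>. \<bar>t * of_int a - n\<bar> < 1/3"
  shows "\<bar>of_int a\<bar> * c < (1/3 :: real)"
proof (rule ccontr)
  assume "\<not> \<bar>of_int a\<bar> * c < (1/3 :: real)"
  then have ge: "1/3 \<le> \<bar>of_int a\<bar> * c" by simp
  then have "a \<noteq> 0" by auto
  \<comment> \<open>This parameter is admissible exactly when the bound fails. It gives
    \<open>t * of_int a = 1/3\<close>, whose distance to the integers is exactly 1/3 and so not
    smaller.\<close>
  define t where "t = 1 / (3 * real_of_int a)"
  have "\<bar>t\<bar> \<le> c" using ge \<open>a \<noteq> 0\<close> by (simp add: t_def abs_mult field_simps)
  from arc[OF this] obtain n where "n \<in> \<int>" "\<bar>t * of_int a - n\<bar> < 1/3" by blast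
  moreover have "t * of_int a = 1/3" using \<open>a \<noteq> 0\<close> by (simp add: t_def)
  ultimately obtain j :: int where "\<bar>1/3 - real_of_int j\<bar> < 1/3" by (auto elim: Ints_cases)
  then have "0 < real_of_int j" "real_of_int j < 1" by linarith+
  then show False by simp
qed

text \<open>A singleton is open because it is a finite open set minus finitely many points, which are closed.
  The finite set comes from the compact cross whose arm in direction \<open>n\<close> is \<open>\<bar>t\<bar> \<le> c\<^sub>n\<close>: mapping
  that arm into the short arc forces the \<open>n\<close>-th coordinate of \<open>g\<close> to be at most \<open>2 \<bar>f\<^sub>n\<bar>\<close> in
  absolute value, in particular to vanish together with \<open>f\<^sub>n\<close>.\<close>

lemma openin_bidual_singleton:
  assumes f: "f \<in> carrier specker_dual"
  shows "openin (group_topology (pontryagin_dual (pontryagin_dual specker_dual)))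
    {evaluation_character f}"
proof -
  let ?T = "group_topology (pontryagin_dual (pontryagin_dual specker_dual))"
  \<comment> \<open>The product of \<open>c n\<close> with the size of the coordinate
    \<open>f (unit_seq n)\<close> is below 1/4, so the evaluation at \<open>f\<close> maps the arm
    into the arc. For a competitor \<open>g\<close>, the bound 1/3 becomes \<open>3 * \<bar>g
    (unit_seq n)\<bar> < 4 * \<bar>f (unit_seq n)\<bar> + 2\<close>; the summand 2 keeps
    \<open>c n\<close> positive and still forces a zero coordinate where \<open>f\<close> has
    one.\<close>
  define c where "c n = 1 / (4 * \<bar>real_of_int (f (unit_seq n))\<bar> + 2)" for n
  have c: "c n > 0" for n by (simp add: c_def add_nonneg_pos)
  define S where "S = {\<psi> \<in> characters (pontryagin_dual specker_dual).
    \<psi> ` cross c \<subseteq> near_zero_arc (1/3)}"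
  have S: "openin ?T S"
    unfolding S_def by (intro openin_compact_open_dual compactin_cross openin_near_zero_arc)
  have evS: "evaluation_character g \<in> S \<longleftrightarrow>
      (\<forall>n t. \<bar>t\<bar> \<le> c n \<longrightarrow> (\<exists>j\<in>\<int>. \<bar>t * of_int (g (unit_seq n)) - j\<bar> < 1/3))"
    if "g \<in> carrier specker_dual" for g
  proof -
    have arm: "evaluation_character g (line_character n t) \<in> near_zero_arc (1/3) \<longleftrightarrow>
      (\<exists>j\<in>\<int>. \<bar>t * of_int (g (unit_seq n)) - j\<bar> < 1/3)" for n t
      using that line_character_in_characters[of n t]
      by (simp add: evaluation_character_def line_character_def circle_of_in_near_zero_arc)
    have "evaluation_character g trivial_character \<in> near_zero_arc (1/3)"
      using that by (auto simp: evaluation_character_def trivial_character_in_characters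
          trivial_character circle_of_in_near_zero_arc intro!: bexI[of _ 0])
    then have "evaluation_character g ` cross c \<subseteq> near_zero_arc (1/3) \<longleftrightarrow>
      (\<forall>n t. \<bar>t\<bar> \<le> c n \<longrightarrow> evaluation_character g (line_character n t) \<in> near_zero_arc (1/3))"
      unfolding cross_def by (auto simp: arm abs_le_iff image_subset_iff)
    then show ?thesis
      using evaluation_character_in_bidual[OF that] by (simp add: S_def arm)
  qed
  have fS: "evaluation_character f \<in> S"
    unfolding evS[OF f]
  proof (intro allI impI)
    fix n and t :: real assume t: "\<bar>t\<bar> \<le> c n"
    have "\<bar>t * of_int (f (unit_seq n))\<bar> \<le> c n * \<bar>of_int (f (unit_seq n))\<bar>"
      unfolding abs_mult using t by (rule mult_right_mono) simp
    also have "\<dots> < 1/3"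
      by (simp add: c_def divide_simps add_nonneg_pos)
    finally show "\<exists>j\<in>\<int>. \<bar>t * of_int (f (unit_seq n)) - j\<bar> < 1/3"
      by (intro bexI[of _ 0]) auto
  qed
  have "finite S"
  proof -
    obtain m where m: "\<And>n. n \<ge> m \<Longrightarrow> f (unit_seq n) = 0"
      using additive_functional_finite_support f by (auto simp: carrier_specker_dual)
    \<comment> \<open>Coordinate vectors are taken extensional on the first \<open>m\<close>
      indices, which makes the box finite.\<close>
    define A where "A = (\<Pi>\<^sub>E n\<in>{..<m}. {- 2 * \<bar>f (unit_seq n)\<bar>..2 * \<bar>f (unit_seq n)\<bar>})"
    have "S \<subseteq> (\<lambda>a. evaluation_character (linear_functional a m)) ` A"
    proof
      fix \<psi> assume \<psi>: "\<psi> \<in> S"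
      then have "\<psi> \<in> characters (pontryagin_dual specker_dual)" by (simp add: S_def)
      from bidual_is_evaluation[OF this] obtain g
        where g: "g \<in> carrier specker_dual" "\<psi> = evaluation_character g" ..
      have bound: "\<bar>g (unit_seq n)\<bar> \<le> 2 * \<bar>f (unit_seq n)\<bar>" for n
      proof -
        have "\<bar>of_int (g (unit_seq n))\<bar> * c n < 1/3"
          using \<psi> g(1) unfolding g(2) evS[OF g(1)] by (intro small_arc_bound c) blast
        then have "3 * \<bar>real_of_int (g (unit_seq n))\<bar> < 4 * \<bar>of_int (f (unit_seq n))\<bar> + 2"
          by (simp add: c_def divide_simps add_nonneg_pos split: if_splits)
        then have "3 * \<bar>g (unit_seq n)\<bar> < 4 * \<bar>f (unit_seq n)\<bar> + 2" by linarith
        then show ?thesis by linarith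
      qed
      define a where "a = (\<lambda>n\<in>{..<m}. g (unit_seq n))"
      have "g (unit_seq n) = 0" if "n \<ge> m" for n using bound[of n] m[OF that] by simp
      then have "g \<in> supported_below m" using g(1) by (simp add: supported_below_def)
      from supported_below_eq_linear_functional[OF this] have "g = linear_functional a m"
        by (simp add: linear_functional_def a_def)
      moreover have "a \<in> A"
      proof -
        have "- 2 * \<bar>f (unit_seq n)\<bar> \<le> g (unit_seq n) \<and> g (unit_seq n) \<le> 2 * \<bar>f (unit_seq n)\<bar>" for n
          using bound[of n] by linarith
        then show ?thesis by (simp add: a_def A_def)
      qed
      ultimately show "\<psi> \<in> (\<lambda>a. evaluation_character (linear_functional a m)) ` A"
        using g(2) by blast
    qed
    moreover have "finite A" unfolding A_def by (intro finite_PiE) auto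
    ultimately show ?thesis by (meson finite_imageI finite_subset)
  qed
  \<comment> \<open>Two characters that differ at \<open>\<xi>\<close> are separated by the compact
    set \<open>{\<xi>}\<close> and the complement of one point of the circle.\<close>
  have "t1_space ?T"
    unfolding t1_space_def
  proof (intro ballI impI)
    fix \<phi> \<psi> assume *: "\<phi> \<in> topspace ?T" "\<psi> \<in> topspace ?T" "\<phi> \<noteq> \<psi>"
    then have char: "\<phi> \<in> characters (pontryagin_dual specker_dual)"
        "\<psi> \<in> characters (pontryagin_dual specker_dual)" by simp_all
    obtain \<xi> where \<xi>: "\<xi> \<in> characters specker_dual" "\<phi> \<xi> \<noteq> \<psi> \<xi>"
      using characters_eqI[OF char] *(3) by auto
    obtain a where a: "\<psi> \<xi> = circle_of a"
      using circle_group_ex[OF character_in_circle[OF char(2), of \<xi>]] \<xi>(1) by auto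
    define U where "U = {\<zeta> \<in> characters (pontryagin_dual specker_dual).
      \<zeta> ` {\<xi>} \<subseteq> carrier circle_group - {circle_of a}}"
    have "openin ?T U"
      unfolding U_def using \<xi>(1) by (intro openin_compact_open_dual openin_circle_minus_point) simp
    moreover have "\<phi> \<in> U" "\<psi> \<notin> U"
      using char \<xi> a character_in_circle[OF char(1)] by (auto simp: U_def)
    ultimately show "\<exists>U. openin ?T U \<and> \<phi> \<in> U \<and> \<psi> \<notin> U" by blast
  qed
  then have "closedin ?T (S - {evaluation_character f})"
    using \<open>finite S\<close> S openin_subset by (subst (asm) t1_space_closedin_finite) blast
  then have "openin ?T (S - (S - {evaluation_character f}))"
    by (rule openin_diff[OF S])
  moreover have "S - (S - {evaluation_character f}) = {evaluation_character f}"
    using fS by blast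
  ultimately show ?thesis by simp
qed

theorem corollary3p2:
  fixes G :: "((nat \<Rightarrow> int) \<Rightarrow> int) top_group"
  assumes "G = pointwise_hom_group baer_specker_group discrete_int_group"
  shows "group_topology (pontryagin_dual (pontryagin_dual G)) =
           discrete_topology (carrier (pontryagin_dual (pontryagin_dual G)))
         \<and> pontryagin_dual (pontryagin_dual G) \<cong> G"
proof -
  have G: "G = specker_dual" using assms by (simp add: specker_dual_def)
  have "discrete_topology (carrier (pontryagin_dual (pontryagin_dual G))) =
      group_topology (pontryagin_dual (pontryagin_dual G))"
    unfolding G discrete_topology_unique
    using openin_bidual_singleton by (auto simp: bidual_eq_evaluations)
  \<comment> \<open>Evaluation runs from \<open>G\<close> to its second dual; the isomorphism is
    inverted, using that \<open>G\<close> is a group.\<close>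
  moreover have "pontryagin_dual (pontryagin_dual G) \<cong> G"
    unfolding G using evaluation_character_iso
    by (intro group.iso_sym[OF group_specker_dual] is_isoI)
  ultimately show ?thesis by simp
qed

end
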